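(* Let $[(M,\mathcal{E}_M),\phi,(G,\mathcal{E}_G,\ast)]$ and $[(\tilde{M},\mathcal{E}_{\tilde{M}}),\tilde{\phi},(\tilde{G},\mathcal{E}_{\tilde{G}},\tilde{\ast})]$ be coarse dynamical systems which are coarse conjugate under a coarse conjugate relation $(f,h)$. Then, for every $m\in M$, $f(O^G(m))=O^{\tilde{G}}(f(m))$.
   Context: Coarse space: a pair $(M,\mathcal{E}_M)$ where $M$ is a set and $\mathcal{E}_M\subseteq P(M\times M)$ (a coarse structure, whose elements are called entourages) contains the diagonal $\{(m,m): m\in M\}$, is closed under taking subsets and under finite unions, and for all $E,F\in\mathcal{E}_M$ contains $E^{-1}=\{(m_2,m_1):(m_1,m_2)\in E\}$ and $E\circ F=\{(m_1,m_2)\in M\times M:\exists\, m_3\in M,\ (m_1,m_3)\in E,\ (m_3,m_2)\in F\}$. Asymorphism: a map $f:(M,\mathcal{E}_M)\to(N,\mathcal{E}_N)$ between coarse spaces is bornologous if $(f\times f)(E)\in\mathcal{E}_N$ for every $E\in\mathcal{E}_M$, where $(f\times f)(m_1,m_2)=(f(m_1),f(m_2))$. An asymorphism is a bijection $f$ such that both $f$ and $f^{-1}$ are bornologous. Coarse group: a triple $(G,\mathcal{E}_G,\ast)$ where $(G,\ast)$ is a group and $\mathcal{E}_G$ is a coarse structure on $G$ such that for every $E\in\mathcal{E}_G$ the set $\{(g\ast e_1,g\ast e_2): g\in G,\ (e_1,e_2)\in E\}$ belongs to $\mathcal{E}_G$. Coarse dynamical system (with coarse time): a triple $[(M,\mathcal{E}_M),\phi,(G,\mathcal{E}_G,\ast)]$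 where $(M,\mathcal{E}_M)$ is a non-empty coarse space, $(G,\mathcal{E}_G,\ast)$ is a coarse group, and $\phi=(\phi^g)_{g\in G}$ is a family of asymorphisms $\phi^g:M\to M$ such that $\phi^{g_1}(\phi^{g_2}(m))=\phi^{g_1\ast g_2}(m)$ for all $g_1,g_2\in G$, $m\in M$, and $\phi^e=\mathrm{Id}_M$, where $e$ is the identity element of $G$. Coarse conjugate relation: a coarse conjugate relation $(f,h)$ between $[(M,\mathcal{E}_M),\phi,(G,\mathcal{E}_G,\ast)]$ and $[(\tilde{M},\mathcal{E}_{\tilde{M}}),\tilde{\phi},(\tilde{G},\mathcal{E}_{\tilde{G}},\tilde{\ast})]$ consists of an asymorphism $f:(M,\mathcal{E}_M)\to(\tilde{M},\mathcal{E}_{\tilde{M}})$ and an asymorphism $h:(G,\mathcal{E}_G)\to(\tilde{G},\mathcal{E}_{\tilde{G}})$ such that $h(g_1\ast g_2)=h(g_1)\,\tilde{\ast}\,h(g_2)$ for all $g_1,g_2\in G$, and $f\circ\phi^g=\tilde{\phi}^{h(g)}\circ f$ for all $g\in G$. Coarse-orbit: for $m\in M$, $O^G(m)=\{\phi^g(m): g\in G\}$; likewise, for $\tilde{m}\in\tilde{M}$, $O^{\tilde{G}}(\tilde{m})=\{\tilde{\phi}^{\tilde{g}}(\tilde{m}):\tilde{g}\in\tilde{G}\}$. *)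

theory Defs
  imports "HOL-Algebra.Group"
begin

text \<open>
  All structures are carrier-based: maps are total functions of the ambient types, but only their
  values on the carriers matter, so equalities of maps are stated pointwise on the carrier.
\<close>

locale coarse_space =
  fixes M :: "'m set" and \<E> :: "('m \<times> 'm) set set"
  assumes entourages_subset: "\<E> \<subseteq> Pow (M \<times> M)"
    and diagonal: "Id_on M \<in> \<E>"
    and subset_closed: "\<And>E F. \<lbrakk>E \<in> \<E>; F \<subseteq> E\<rbrakk> \<Longrightarrow> F \<in> \<E>"
    and finite_Union_closed: "\<And>\<F>. \<lbrakk>finite \<F>; \<F> \<subseteq> \<E>\<rbrakk> \<Longrightarrow> \<Union>\<F> \<in> \<E>"
    and converse_closed: "\<And>E. E \<in> \<E> \<Longrightarrow> E\<inverse> \<in> \<E>"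
    and relcomp_closed: "\<And>E F. \<lbrakk>E \<in> \<E>; F \<in> \<E>\<rbrakk> \<Longrightarrow> E O F \<in> \<E>"

definition bornologous ::
    "'m set \<Rightarrow> ('m \<times> 'm) set set \<Rightarrow> 'n set \<Rightarrow> ('n \<times> 'n) set set \<Rightarrow> ('m \<Rightarrow> 'n) \<Rightarrow> bool" where
  "bornologous M \<E>\<^sub>M N \<E>\<^sub>N f \<longleftrightarrow> f ` M \<subseteq> N \<and> (\<forall>E\<in>\<E>\<^sub>M. map_prod f f ` E \<in> \<E>\<^sub>N)"

definition asymorphism ::
    "'m set \<Rightarrow> ('m \<times> 'm) set set \<Rightarrow> 'n set \<Rightarrow> ('n \<times> 'n) set set \<Rightarrow> ('m \<Rightarrow> 'n) \<Rightarrow> bool" where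
  "asymorphism M \<E>\<^sub>M N \<E>\<^sub>N f \<longleftrightarrow>
     bij_betw f M N \<and> bornologous M \<E>\<^sub>M N \<E>\<^sub>N f \<and> bornologous N \<E>\<^sub>N M \<E>\<^sub>M (inv_into M f)"

locale coarse_group = group G + coarse_space "carrier G" \<E>
  for G :: "('g, 'x) monoid_scheme" (structure) and \<E> :: "('g \<times> 'g) set set" +
  assumes translates_entourage:
    "\<And>E. E \<in> \<E> \<Longrightarrow> {(g \<otimes> e\<^sub>1, g \<otimes> e\<^sub>2) | g e\<^sub>1 e\<^sub>2. g \<in> carrier G \<and> (e\<^sub>1, e\<^sub>2) \<in> E} \<in> \<E>"

locale coarse_dynamical_system =
  space: coarse_space M \<E>\<^sub>M + time: coarse_group G \<E>\<^sub>G
  for M :: "'m set" and \<E>\<^sub>M :: "('m \<times> 'm) set set"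
    and \<phi> :: "'g \<Rightarrow> 'm \<Rightarrow> 'm"
    and G :: "('g, 'x) monoid_scheme" (structure) and \<E>\<^sub>G :: "('g \<times> 'g) set set" +
  assumes nonempty: "M \<noteq> {}"
    and asymorphism_flow: "\<And>g. g \<in> carrier G \<Longrightarrow> asymorphism M \<E>\<^sub>M M \<E>\<^sub>M (\<phi> g)"
    and flow_mult: "\<And>g\<^sub>1 g\<^sub>2 m. \<lbrakk>g\<^sub>1 \<in> carrier G; g\<^sub>2 \<in> carrier G; m \<in> M\<rbrakk>
           \<Longrightarrow> \<phi> g\<^sub>1 (\<phi> g\<^sub>2 m) = \<phi> (g\<^sub>1 \<otimes> g\<^sub>2) m"
    and flow_one: "\<And>m. m \<in> M \<Longrightarrow> \<phi> \<one> m = m"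

definition coarse_conjugate_relation ::
    "'m set \<Rightarrow> ('m \<times> 'm) set set \<Rightarrow> ('g \<Rightarrow> 'm \<Rightarrow> 'm) \<Rightarrow> ('g, 'x) monoid_scheme \<Rightarrow> ('g \<times> 'g) set set \<Rightarrow>
     'n set \<Rightarrow> ('n \<times> 'n) set set \<Rightarrow> ('h \<Rightarrow> 'n \<Rightarrow> 'n) \<Rightarrow> ('h, 'y) monoid_scheme \<Rightarrow> ('h \<times> 'h) set set \<Rightarrow>
     ('m \<Rightarrow> 'n) \<Rightarrow> ('g \<Rightarrow> 'h) \<Rightarrow> bool" where
  "coarse_conjugate_relation M \<E>\<^sub>M \<phi> G \<E>\<^sub>G N \<E>\<^sub>N \<psi> H \<E>\<^sub>H f h \<longleftrightarrow>
     asymorphism M \<E>\<^sub>M N \<E>\<^sub>N f \<and>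
     asymorphism (carrier G) \<E>\<^sub>G (carrier H) \<E>\<^sub>H h \<and>
     h \<in> hom G H \<and>
     (\<forall>g\<in>carrier G. \<forall>m\<in>M. f (\<phi> g m) = \<psi> (h g) (f m))"

definition coarse_orbit :: "('g, 'x) monoid_scheme \<Rightarrow> ('g \<Rightarrow> 'm \<Rightarrow> 'm) \<Rightarrow> 'm \<Rightarrow> 'm set" where
  "coarse_orbit G \<phi> m = {\<phi> g m | g. g \<in> carrier G}"

end

theory Submission
  imports Defs
begin

text \<open>
  The intertwining relation turns the orbit map of \<open>m\<close> followed by \<open>f\<close> into \<open>h\<close> followed by the orbit
  map of \<open>f m\<close>. So \<open>f\<close> carries the orbit of \<open>m\<close> into that of \<open>f m\<close>, and it reaches all of it because
  \<open>h\<close> is onto: every time of the second system is the image of a time of the first.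
\<close>

theorem theorem3p6:
  fixes M :: "'m set" and \<E>\<^sub>M :: "('m \<times> 'm) set set" and \<phi> :: "'g \<Rightarrow> 'm \<Rightarrow> 'm"
    and G :: "('g, 'x) monoid_scheme" and \<E>\<^sub>G :: "('g \<times> 'g) set set"
    and N :: "'n set" and \<E>\<^sub>N :: "('n \<times> 'n) set set" and \<psi> :: "'h \<Rightarrow> 'n \<Rightarrow> 'n"
    and H :: "('h, 'y) monoid_scheme" and \<E>\<^sub>H :: "('h \<times> 'h) set set"
    and f :: "'m \<Rightarrow> 'n" and h :: "'g \<Rightarrow> 'h"
  assumes "coarse_dynamical_system M \<E>\<^sub>M \<phi> G \<E>\<^sub>G"
    and "coarse_dynamical_system N \<E>\<^sub>N \<psi> H \<E>\<^sub>H"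
    and "coarse_conjugate_relation M \<E>\<^sub>M \<phi> G \<E>\<^sub>G N \<E>\<^sub>N \<psi> H \<E>\<^sub>H f h"
  shows "\<forall>m\<in>M. f ` coarse_orbit G \<phi> m = coarse_orbit H \<psi> (f m)"
proof
  fix m assume m: "m \<in> M"
  have intertwine: "f (\<phi> g m) = \<psi> (h g) (f m)" if "g \<in> carrier G" for g
    using assms(3) m that by (simp add: coarse_conjugate_relation_def)
  have onto: "h ` carrier G = carrier H"
    using assms(3)
    by (auto simp: coarse_conjugate_relation_def asymorphism_def dest: bij_betw_imp_surj_on)
  have "f ` coarse_orbit G \<phi> m = (\<lambda>g. f (\<phi> g m)) ` carrier G"
    by (auto simp: coarse_orbit_def)
  also have "\<dots> = (\<lambda>g. \<psi> (h g) (f m)) ` carrier G"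
    by (rule image_cong) (simp_all add: intertwine)
  also have "\<dots> = (\<lambda>k. \<psi> k (f m)) ` carrier H"
    unfolding onto[symmetric] image_image ..
  also have "\<dots> = coarse_orbit H \<psi> (f m)"
    by (auto simp: coarse_orbit_def)
  finally show "f ` coarse_orbit G \<phi> m = coarse_orbit H \<psi> (f m)" .
qed

end
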